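(* Let $k$ be a field and $X=\{x_1,\ldots,x_\mu\}$ a finite set of noncommuting variables. For every right $k\langle X\rangle$-module $M$ that is finite-dimensional over $k$, the characteristic function $\chi_M\in k\langle\langle X\rangle\rangle$ is a rational series, i.e. $\chi_M\in\mathcal R$. Moreover $\chi$ is additive for short exact sequences: if $0\to M'\to M\to M''\to 0$ is a short exact sequence of finite-dimensional right $k\langle X\rangle$-modules, then $\chi_M=\chi_{M'}+\chi_{M''}$.
   Context: $k\langle X\rangle$ is the free associative unital $k$-algebra (noncommutative polynomials) on $X$, and $k\langle\langle X\rangle\rangle$ is the $k$-algebra of noncommutative formal power series in $x_1,\ldots,x_\mu$. $X^*$ is the free monoid on $X$; its elements are called words. The ring $\mathcal R$ of noncommutative rational series is the smallest $k$-subalgebra of $k\langle\langle X\rangle\rangle$ such that (i) $k\langle X\rangle\subset\mathcal R$, and (ii) if $g\in\mathcal R$ and $g$ is invertible in $k\langle\langle X\rangle\rangle$, then $g^{-1}\in\mathcal R$. For a right $k\langle X\rangle$-module $M$, finite-dimensional over $k$, let $u_i\in\mathrm{End}_k(M)$ be the endomorphism given by the action of $x_i$, and let $\alpha:k\langle X\rangle\to\mathrm{End}_k(M)$ be the $k$-algebra homomorphism with $\alpha(x_i)=u_i$ (endomorphisms are written on the right of their arguments, so $\alpha(x_{i_1}\cdots x_{i_p})$ means: apply $u_{i_1}$ first, then $u_{i_2}$, etc.). The characteristic function of $M$ is $$\chi_M=\sum_{w\in X^*}\mathrm{Tr}(\alpha(w))\,w\in k\langle\langle X\rangle\rangle .$$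 *)

theory Defs
  imports Complex_Main "HOL-Library.Poly_Mapping"
begin

text \<open>Lists over \<open>'x\<close> form the free monoid on \<open>'x\<close>. It is written additively because
  \<^theory>\<open>HOL-Library.Poly_Mapping\<close> builds the (possibly noncommutative) monoid algebra over an
  additively written monoid; so \<open>k\<langle>X\<rangle>\<close> is the type \<open>'x list \<Rightarrow>\<^sub>0 'k\<close>.\<close>

instantiation list :: (type) monoid_add
begin

definition zero_list :: "'a list" where
  "zero_list = []"

definition plus_list :: "'a list \<Rightarrow> 'a list \<Rightarrow> 'a list" where
  "plus_list u v = u @ v"

instance
  by standard (simp_all add: zero_list_def plus_list_def)

end

type_synonym ('x, 'k) nc_poly = "'x list \<Rightarrow>\<^sub>0 'k"

definition nc_monom :: "'x list \<Rightarrow> ('x, 'k::field) nc_poly" where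
  "nc_monom w = Poly_Mapping.single w 1"

definition nc_const :: "'k \<Rightarrow> ('x, 'k::field) nc_poly" where
  "nc_const c = Poly_Mapping.single [] c"

lemma nc_monom_Nil: "nc_monom [] = 1"
  by (simp add: nc_monom_def zero_list_def[symmetric])

lemma nc_monom_append: "nc_monom (u @ v) = nc_monom u * nc_monom v"
  by (simp add: nc_monom_def mult_single plus_list_def)

typedef ('x, 'k) nc_series = "UNIV :: ('x list \<Rightarrow> 'k) set"
  morphisms coeff Series ..

lemma coeff_Series [simp]: "coeff (Series f) = f"
  by (simp add: Series_inverse)

lemma nc_series_eqI: "(\<And>w. coeff f w = coeff g w) \<Longrightarrow> f = g"
  by (metis coeff_inverse ext)

lemma splits_eq: "{(u, v). u @ v = w} = (\<lambda>i. (take i w, drop i w)) ` {..length w}"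
proof (intro equalityI subsetI)
  fix p assume "p \<in> {(u, v). u @ v = w}"
  then show "p \<in> (\<lambda>i. (take i w, drop i w)) ` {..length w}"
    by (intro image_eqI[where x = "length (fst p)"]) auto
qed auto

lemma finite_splits [simp]: "finite {(u, v). u @ v = w}"
  by (simp add: splits_eq)

instantiation nc_series :: (type, ring_1) ring_1
begin

definition zero_nc_series :: "('a, 'b) nc_series" where
  "0 = Series (\<lambda>w. 0)"

definition one_nc_series :: "('a, 'b) nc_series" where
  "1 = Series (\<lambda>w. if w = [] then 1 else 0)"

definition plus_nc_series :: "('a, 'b) nc_series \<Rightarrow> ('a, 'b) nc_series \<Rightarrow> ('a, 'b) nc_series" where
  "f + g = Series (\<lambda>w. coeff f w + coeff g w)"

definition uminus_nc_series :: "('a, 'b) nc_series \<Rightarrow> ('a, 'b) nc_series" where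
  "- f = Series (\<lambda>w. - coeff f w)"

definition minus_nc_series :: "('a, 'b) nc_series \<Rightarrow> ('a, 'b) nc_series \<Rightarrow> ('a, 'b) nc_series" where
  "f - g = Series (\<lambda>w. coeff f w - coeff g w)"

definition times_nc_series :: "('a, 'b) nc_series \<Rightarrow> ('a, 'b) nc_series \<Rightarrow> ('a, 'b) nc_series" where
  "f * g = Series (\<lambda>w. \<Sum>(u, v) | u @ v = w. coeff f u * coeff g v)"

instance
proof
  fix f g h :: "('a, 'b) nc_series"
  show "f + g + h = f + (g + h)" "f + g = g + f" "0 + f = f" "- f + f = 0" "f - g = f + - g"
    by (rule nc_series_eqI, simp add: plus_nc_series_def zero_nc_series_def
        uminus_nc_series_def minus_nc_series_def algebra_simps)+
  show "(0 :: ('a, 'b) nc_series) \<noteq> 1"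
  proof
    assume "(0 :: ('a, 'b) nc_series) = 1"
    then have "coeff (0 :: ('a, 'b) nc_series) [] = coeff 1 []"
      by simp
    then show False
      by (simp add: zero_nc_series_def one_nc_series_def)
  qed
  show "(f + g) * h = f * h + g * h" "f * (g + h) = f * g + f * h"
    by (rule nc_series_eqI, simp add: plus_nc_series_def times_nc_series_def
        case_prod_beta algebra_simps sum.distrib)+
  show "1 * f = f"
  proof (rule nc_series_eqI)
    fix w
    have "(\<Sum>(u, v) | u @ v = w. coeff 1 u * coeff f v) = (\<Sum>(u, v) \<in> {([], w)}. coeff 1 u * coeff f v)"
      by (rule sum.mono_neutral_right) (auto simp: one_nc_series_def split: if_splits)
    then show "coeff (1 * f) w = coeff f w"
      by (simp add: times_nc_series_def one_nc_series_def)
  qed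
  show "f * 1 = f"
  proof (rule nc_series_eqI)
    fix w
    have "(\<Sum>(u, v) | u @ v = w. coeff f u * coeff 1 v) = (\<Sum>(u, v) \<in> {(w, [])}. coeff f u * coeff 1 v)"
      by (rule sum.mono_neutral_right) (auto simp: one_nc_series_def split: if_splits)
    then show "coeff (f * 1) w = coeff f w"
      by (simp add: times_nc_series_def one_nc_series_def)
  qed
  show "f * g * h = f * (g * h)"
  proof (rule nc_series_eqI)
    fix w
    let ?S = "\<lambda>w. {(u, v). u @ v = w}"
    have "coeff (f * g * h) w
        = (\<Sum>p \<in> ?S w. \<Sum>q \<in> ?S (fst p). coeff f (fst q) * coeff g (snd q) * coeff h (snd p))"
      by (simp add: times_nc_series_def case_prod_beta sum_distrib_right)
    also have "\<dots> = (\<Sum>(p, q) \<in> Sigma (?S w) (\<lambda>p. ?S (fst p)).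
        coeff f (fst q) * coeff g (snd q) * coeff h (snd p))"
      by (rule sum.Sigma) auto
    also have "\<dots> = (\<Sum>(p, q) \<in> Sigma (?S w) (\<lambda>p. ?S (snd p)).
        coeff f (fst p) * (coeff g (fst q) * coeff h (snd q)))"
      by (rule sum.reindex_bij_witness
          [where j = "\<lambda>((u, v), (a, b)). ((a, b @ v), (b, v))"
             and i = "\<lambda>((u, v), (a, b)). ((u @ a, b), (u, a))"])
        (auto simp: mult.assoc)
    also have "\<dots> = (\<Sum>p \<in> ?S w. \<Sum>q \<in> ?S (snd p).
        coeff f (fst p) * (coeff g (fst q) * coeff h (snd q)))"
      by (rule sum.Sigma[symmetric]) auto
    also have "\<dots> = coeff (f * (g * h)) w"
      by (simp add: times_nc_series_def case_prod_beta sum_distrib_left)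
    finally show "coeff (f * g * h) w = coeff (f * (g * h)) w" .
  qed
qed

end

definition series_scale :: "'k::field \<Rightarrow> ('x, 'k) nc_series \<Rightarrow> ('x, 'k) nc_series" where
  "series_scale c f = Series (\<lambda>w. c * coeff f w)"

interpretation nc_series: vector_space "series_scale :: 'k::field \<Rightarrow> ('x, 'k) nc_series \<Rightarrow> _"
  by standard
    (rule nc_series_eqI, simp add: series_scale_def plus_nc_series_def algebra_simps)+

definition series_of_poly :: "('x, 'k::field) nc_poly \<Rightarrow> ('x, 'k) nc_series" where
  "series_of_poly p = Series (Poly_Mapping.lookup p)"

lemma series_of_poly_add: "series_of_poly (p + q) = series_of_poly p + series_of_poly q"
  by (rule nc_series_eqI) (simp add: series_of_poly_def plus_nc_series_def lookup_add)

lemma poly_update_eq: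
  assumes "w \<notin> Poly_Mapping.keys p"
  shows "Poly_Mapping.update w a p = p + Poly_Mapping.single w a"
  by (rule poly_mapping_eqI)
    (use assms in \<open>auto simp: lookup_update lookup_add lookup_single in_keys_iff\<close>)

lemma series_of_poly_mult: "series_of_poly (p * q) = series_of_poly p * series_of_poly q"
proof -
  have zero: "series_of_poly 0 = 0"
    by (rule nc_series_eqI) (simp add: series_of_poly_def zero_nc_series_def)
  have monom: "series_of_poly (Poly_Mapping.single u a * Poly_Mapping.single v b)
      = series_of_poly (Poly_Mapping.single u a) * series_of_poly (Poly_Mapping.single v b)"
    for u v :: "'a list" and a b :: 'b
  proof (rule nc_series_eqI)
    fix w
    have "(\<Sum>(s, t) | s @ t = w. (a when u = s) * (b when v = t))
        = (\<Sum>(s, t) \<in> (if u @ v = w then {(u, v)} else {}). (a when u = s) * (b when v = t))"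
      by (rule sum.mono_neutral_right) (auto simp: when_def split: if_splits)
    then show "coeff (series_of_poly (Poly_Mapping.single u a * Poly_Mapping.single v b)) w
        = coeff (series_of_poly (Poly_Mapping.single u a) * series_of_poly (Poly_Mapping.single v b)) w"
      by (simp add: series_of_poly_def times_nc_series_def mult_single lookup_single plus_list_def)
  qed
  have single: "series_of_poly (Poly_Mapping.single u a * q)
      = series_of_poly (Poly_Mapping.single u a) * series_of_poly q" for u :: "'a list" and a :: 'b
  proof (induction q rule: update_induct)
    case (update q v b)
    then show ?case
      by (simp add: poly_update_eq distrib_left series_of_poly_add monom)
  qed (simp add: zero)
  show ?thesis
  proof (induction p rule: update_induct)
    case (update p u a)
    then show ?case
      by (simp add: poly_update_eq distrib_right series_of_poly_add single)
  qed (simp add: zero)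
qed

definition series_subalgebra :: "('x, 'k::field) nc_series set \<Rightarrow> bool" where
  "series_subalgebra A \<longleftrightarrow>
     nc_series.subspace A \<and> 1 \<in> A \<and> (\<forall>f\<in>A. \<forall>g\<in>A. f * g \<in> A)"

definition inverse_closed :: "'r::ring_1 set \<Rightarrow> bool" where
  "inverse_closed A \<longleftrightarrow> (\<forall>g\<in>A. \<forall>h. g * h = 1 \<and> h * g = 1 \<longrightarrow> h \<in> A)"

definition rational_series :: "('x, 'k::field) nc_series set" where
  "rational_series =
     \<Inter>{A. series_subalgebra A \<and> range series_of_poly \<subseteq> A \<and> inverse_closed A}"

lemma rational_series_least:
  shows "series_subalgebra rational_series"
    and "range series_of_poly \<subseteq> rational_series"
    and "inverse_closed rational_series"
    and "\<lbrakk>series_subalgebra A; range series_of_poly \<subseteq> A; inverse_closed A\<rbrakk>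
           \<Longrightarrow> rational_series \<subseteq> A"
proof -
  show "series_subalgebra rational_series"
    unfolding series_subalgebra_def
  proof (intro conjI ballI)
    show "nc_series.subspace rational_series"
      unfolding rational_series_def
      by (rule nc_series.subspace_Inter) (auto simp: series_subalgebra_def)
  qed (simp_all add: rational_series_def series_subalgebra_def)
  show "range series_of_poly \<subseteq> rational_series"
    unfolding rational_series_def by blast
  show "inverse_closed rational_series"
    unfolding rational_series_def inverse_closed_def by blast
  show "\<lbrakk>series_subalgebra A; range series_of_poly \<subseteq> A; inverse_closed A\<rbrakk>
           \<Longrightarrow> rational_series \<subseteq> A"
    unfolding rational_series_def by blast
qed

locale right_module =
  fixes act :: "'m::ab_group_add \<Rightarrow> 'r::ring_1 \<Rightarrow> 'm"
  assumes act_add_left: "act (m + n) a = act m a + act n a"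
    and act_add_right: "act m (a + b) = act m a + act m b"
    and act_mult: "act m (a * b) = act (act m a) b"
    and act_one: "act m 1 = m"

definition right_module_hom ::
    "('m::ab_group_add \<Rightarrow> 'r::ring_1 \<Rightarrow> 'm) \<Rightarrow> ('n::ab_group_add \<Rightarrow> 'r \<Rightarrow> 'n) \<Rightarrow> ('m \<Rightarrow> 'n) \<Rightarrow> bool"
  where "right_module_hom actM actN f \<longleftrightarrow>
     right_module actM \<and> right_module actN \<and>
     (\<forall>m n. f (m + n) = f m + f n) \<and> (\<forall>m a. f (actM m a) = actN (f m) a)"

definition short_exact ::
    "('l::ab_group_add \<Rightarrow> 'r::ring_1 \<Rightarrow> 'l) \<Rightarrow> ('m::ab_group_add \<Rightarrow> 'r \<Rightarrow> 'm) \<Rightarrow>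
     ('n::ab_group_add \<Rightarrow> 'r \<Rightarrow> 'n) \<Rightarrow> ('l \<Rightarrow> 'm) \<Rightarrow> ('m \<Rightarrow> 'n) \<Rightarrow> bool"
  where "short_exact actL actM actN f g \<longleftrightarrow>
     right_module_hom actL actM f \<and> right_module_hom actM actN g \<and>
     inj f \<and> range f = {m. g m = 0} \<and> surj g"

text \<open>\<open>k\<close> acts on a right \<open>k\<langle>X\<rangle>\<close>-module through the constant polynomials, which are central.\<close>

definition module_scale ::
    "('m::ab_group_add \<Rightarrow> ('x, 'k::field) nc_poly \<Rightarrow> 'm) \<Rightarrow> 'k \<Rightarrow> 'm \<Rightarrow> 'm"
  where "module_scale act c m = act m (nc_const c)"

lemma vector_space_module_scale:
  fixes act :: "'m::ab_group_add \<Rightarrow> ('x, 'k::field) nc_poly \<Rightarrow> 'm"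
  assumes "right_module act"
  shows "vector_space (module_scale act)"
proof -
  interpret right_module act by fact
  have mult: "nc_const (a * b) = nc_const b * (nc_const a :: ('x, 'k) nc_poly)" for a b
    by (simp add: nc_const_def mult_single plus_list_def mult.commute)
  have one: "nc_const 1 = (1 :: ('x, 'k) nc_poly)"
    using nc_monom_Nil by (simp add: nc_const_def nc_monom_def)
  have add: "nc_const (a + b) = nc_const a + (nc_const b :: ('x, 'k) nc_poly)" for a b
    by (simp add: nc_const_def single_add)
  show ?thesis
  proof
    fix a b :: 'k and m n :: 'm
    show "module_scale act a (m + n) = module_scale act a m + module_scale act a n"
      by (simp only: module_scale_def act_add_left)
    show "module_scale act (a + b) m = module_scale act a m + module_scale act b m"
      by (simp only: module_scale_def add act_add_right)
    show "module_scale act a (module_scale act b m) = module_scale act (a * b) m"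
      by (simp only: module_scale_def mult act_mult)
    show "module_scale act 1 m = m"
      by (simp only: module_scale_def one act_one)
  qed
qed

definition fin_dim_module ::
    "('m::ab_group_add \<Rightarrow> ('x, 'k::field) nc_poly \<Rightarrow> 'm) \<Rightarrow> bool"
  where "fin_dim_module act \<longleftrightarrow>
     right_module act \<and> (\<exists>B. finite_dimensional_vector_space (module_scale act) B)"

text \<open>Only meaningful in finite dimension, where the value does not depend on the chosen basis.\<close>

definition (in vector_space) trace :: "('b \<Rightarrow> 'b) \<Rightarrow> 'a" where
  "trace f = (let B = SOME B. independent B \<and> span B = UNIV
              in \<Sum>b\<in>B. representation B (f b) b)"

definition generator_endo ::
    "('m::ab_group_add \<Rightarrow> ('x, 'k::field) nc_poly \<Rightarrow> 'm) \<Rightarrow> 'x \<Rightarrow> 'm \<Rightarrow> 'm"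
  where "generator_endo act x m = act m (nc_monom [x])"

text \<open>As maps are written on the right, the product of \<open>End\<^sub>k(M)\<close> is composition in diagrammatic
  order, and the lemmas below say that this is the \<open>k\<close>-algebra homomorphism
  \<open>k\<langle>X\<rangle> \<rightarrow> End\<^sub>k(M)\<close> sending \<open>x\<close> to \<open>generator_endo act x\<close>; on a word it applies the first letter first.\<close>

definition module_rep ::
    "('m::ab_group_add \<Rightarrow> ('x, 'k::field) nc_poly \<Rightarrow> 'm) \<Rightarrow> ('x, 'k) nc_poly \<Rightarrow> 'm \<Rightarrow> 'm"
  where "module_rep act p m = act m p"

lemma module_rep_generator: "module_rep act (nc_monom [x]) = generator_endo act x"
  by (simp add: fun_eq_iff module_rep_def generator_endo_def)

lemma module_rep_add:
  "right_module act \<Longrightarrow> module_rep act (p + q) m = module_rep act p m + module_rep act q m"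
  by (simp add: module_rep_def right_module.act_add_right)

lemma module_rep_const: "module_rep act (nc_const c) = module_scale act c"
  by (simp add: fun_eq_iff module_rep_def module_scale_def)

lemma module_rep_mult:
  "right_module act \<Longrightarrow> module_rep act (p * q) = module_rep act q \<circ> module_rep act p"
  by (simp add: fun_eq_iff module_rep_def right_module.act_mult)

lemma linear_module_rep:
  assumes "right_module act"
  shows "Vector_Spaces.linear (module_scale act) (module_scale act) (module_rep act p)"
proof -
  interpret right_module act by fact
  interpret vector_space "module_scale act"
    by (rule vector_space_module_scale) fact
  have central: "nc_const c * p = p * nc_const c" for c
  proof (induction p rule: update_induct)
    case const
    show ?case by simp
  next
    case (update p w a)
    have "Poly_Mapping.update w a p = p + Poly_Mapping.single w a"
      using update(1) by (rule poly_update_eq)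
    moreover have "nc_const c * Poly_Mapping.single w a = Poly_Mapping.single w a * nc_const c"
      by (simp add: nc_const_def mult_single plus_list_def mult.commute)
    ultimately show ?case
      using update(3) by (simp add: algebra_simps)
  qed
  show ?thesis
    by unfold_locales
      (simp_all add: module_rep_def module_scale_def act_add_left act_mult[symmetric] central)
qed

lemma module_rep_word:
  assumes "right_module act"
  shows "module_rep act (nc_monom w) = fold (generator_endo act) w"
proof (induction w)
  case Nil
  then show ?case
    using assms by (simp add: fun_eq_iff module_rep_def nc_monom_Nil right_module.act_one)
next
  case (Cons x w)
  have "nc_monom (x # w) = nc_monom [x] * nc_monom w"
    using nc_monom_append[of "[x]" w] by simp
  then have "module_rep act (nc_monom (x # w)) = module_rep act (nc_monom w) \<circ> module_rep act (nc_monom [x])"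
    using module_rep_mult[OF assms] by metis
  then show ?case
    by (simp add: Cons module_rep_generator)
qed

definition char_fun ::
    "('m::ab_group_add \<Rightarrow> ('x, 'k::field) nc_poly \<Rightarrow> 'm) \<Rightarrow> ('x, 'k) nc_series"
  where "char_fun act =
     Series (\<lambda>w. vector_space.trace (module_scale act) (module_rep act (nc_monom w)))"

end

theory Submission
  imports Defs
begin

text \<open>
  Rationality: in a basis \<open>B\<close> of \<open>M\<close>, the matrix entries of \<open>\<alpha>(w)\<close> define series
  \<open>F\<^sub>b\<^sub>c\<close>. Splitting off the first letter of a word gives the linear system
  \<open>F\<^sub>b\<^sub>c = \<delta>\<^sub>b\<^sub>c + \<Sum>\<^sub>d a\<^sub>b\<^sub>d F\<^sub>d\<^sub>c\<close> with linear forms \<open>a\<^sub>b\<^sub>d\<close>. Gaussian elimination solves it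
  rationally, since each pivot \<open>1 - a\<close> has \<open>a\<close> without constant term and so is invertible;
  \<open>\<chi>\<^sub>M\<close> is the sum of the \<open>F\<^sub>b\<^sub>b\<close>.

  Additivity: the trace of \<open>T\<close> is \<open>\<Sum>\<^sub>i \<phi>\<^sub>i (T e\<^sub>i)\<close> for any vectors \<open>e\<^sub>i\<close> and functionals \<open>\<phi>\<^sub>i\<close>
  with \<open>v = \<Sum>\<^sub>i \<phi>\<^sub>i(v) e\<^sub>i\<close>. Applied to the images of a basis of \<open>M'\<close> together with lifts of
  a basis of \<open>M''\<close>, this sum falls apart into the traces on \<open>M'\<close> and \<open>M''\<close>.
\<close>

section \<open>Rational series\<close>

lemma coeff_zero [simp]: "coeff 0 w = 0"
  by (simp add: zero_nc_series_def)

lemma coeff_one: "coeff 1 w = (if w = [] then 1 else 0)"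
  by (simp add: one_nc_series_def)

lemma coeff_add [simp]: "coeff (f + g) w = coeff f w + coeff g w"
  by (simp add: plus_nc_series_def)

lemma coeff_diff [simp]: "coeff (f - g) w = coeff f w - coeff g w"
  by (simp add: minus_nc_series_def)

lemma coeff_mult: "coeff (f * g) w = (\<Sum>(u, v) | u @ v = w. coeff f u * coeff g v)"
  by (simp add: times_nc_series_def)

lemma coeff_sum: "coeff (\<Sum>i\<in>I. f i) w = (\<Sum>i\<in>I. coeff (f i) w)"
  by (induction I rule: infinite_finite_induct) auto

lemma coeff_mult_Nil [simp]: "coeff (f * g) [] = coeff f [] * coeff g []"
proof -
  have "{(u, v). u @ v = []} = {([], [])}"
    by auto
  then show ?thesis
    by (simp add: coeff_mult)
qed

text \<open>A splitting of \<open>x # w\<close> either has empty first part or arises from a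
  splitting of \<open>w\<close> by putting \<open>x\<close> in front of the first part.\<close>

lemma coeff_mult_Cons:
  "coeff (f * g) (x # w) = coeff f [] * coeff g (x # w) + (\<Sum>(u, v) | u @ v = w. coeff f (x # u) * coeff g v)"
proof -
  let ?h = "\<lambda>p. (x # fst p, snd p)"
  have split: "{(u, v). u @ v = x # w} = insert ([], x # w) (?h ` {(u, v). u @ v = w})"
    by (auto simp: append_eq_Cons_conv image_iff)
  have "inj_on ?h {(u, v). u @ v = w}"
    by (auto simp: inj_on_def prod_eq_iff)
  note reindex = sum.reindex[OF this]
  have "([], x # w) \<notin> ?h ` {(u, v). u @ v = w}"
    by auto
  then show ?thesis
    by (simp add: coeff_mult split reindex case_prod_beta)
qed

text \<open>Each factor \<open>a\<close> uses up at least one letter. This makes the geometric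
  series in \<open>a\<close> a finite sum at every word.\<close>

lemma coeff_power_eq_0:
  assumes "coeff a [] = 0" "length w < n"
  shows "coeff (a ^ n) w = 0"
  using assms(2)
proof (induction n arbitrary: w)
  case (Suc n)
  show ?case
  proof (cases w)
    case (Cons x v)
    have "coeff (a ^ n) u' = 0" if "u @ u' = v" for u u'
      using that Suc Cons by auto
    then show ?thesis
      using Cons by (auto simp: coeff_mult_Cons assms(1) intro!: sum.neutral)
  qed (simp add: assms(1))
qed simp

lemma one_minus_invertible:
  fixes a :: "('x, 'k::ring_1) nc_series"
  assumes "coeff a [] = 0"
  obtains h where "(1 - a) * h = 1" "h * (1 - a) = 1"
proof
  define s where "s = (\<lambda>N. \<Sum>n<Suc N. a ^ n)"
  \<comment> \<open>The coefficient of the geometric series at \<open>w\<close> is read off the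
    partial sum up to \<open>a ^ length w\<close>, since all higher powers vanish at
    \<open>w\<close>.\<close>
  define h where "h = Series (\<lambda>w. coeff (s (length w)) w)"
  have h: "coeff h w = coeff (s N) w" if "length w \<le> N" for w N
  proof -
    have "coeff (s N) w = (\<Sum>n<Suc N. coeff (a ^ n) w)"
      by (simp only: s_def coeff_sum)
    also have "\<dots> = (\<Sum>n<Suc (length w). coeff (a ^ n) w)"
      using that by (intro sum.mono_neutral_right)
        (auto intro!: coeff_power_eq_0[OF assms])
    finally show ?thesis
      by (simp only: h_def s_def coeff_sum coeff_Series)
  qed
  have right: "(1 - a) * s N = 1 - a ^ Suc N" for N
  proof (induction N)
    case (Suc N)
    have "(1 - a) * s (Suc N) = (1 - a) * s N + (1 - a) * a ^ Suc N"
      by (simp add: s_def distrib_left add.assoc)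
    also have "\<dots> = 1 - a ^ Suc (Suc N)"
      by (simp only: Suc) (simp add: left_diff_distrib)
    finally show ?case .
  qed (simp add: s_def)
  have left: "s N * (1 - a) = 1 - a ^ Suc N" for N
  proof (induction N)
    case (Suc N)
    have "s (Suc N) * (1 - a) = s N * (1 - a) + a ^ Suc N * (1 - a)"
      by (simp add: s_def distrib_right add.assoc)
    also have "\<dots> = 1 - a ^ Suc (Suc N)"
      by (simp only: Suc) (simp add: right_diff_distrib power_commutes mult.assoc)
    finally show ?case .
  qed (simp add: s_def)
  show "(1 - a) * h = 1"
  proof (rule nc_series_eqI)
    fix w
    \<comment> \<open>Only factors of \<open>w\<close> occur, none longer than \<open>w\<close>, so
      a single partial sum replaces \<open>h\<close>; the remainder
      \<open>a ^ Suc (length w)\<close> of the telescoping sum vanishes at \<open>w\<close>.\<close>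
    have "coeff ((1 - a) * h) w = coeff ((1 - a) * s (length w)) w"
      unfolding coeff_mult by (auto intro!: sum.cong arg_cong2[where f = "(*)"] h)
    then show "coeff ((1 - a) * h) w = coeff 1 w"
      by (simp only: right coeff_diff coeff_power_eq_0[OF assms] lessI diff_zero)
  qed
  show "h * (1 - a) = 1"
  proof (rule nc_series_eqI)
    fix w
    have "coeff (h * (1 - a)) w = coeff (s (length w) * (1 - a)) w"
      unfolding coeff_mult by (auto intro!: sum.cong arg_cong2[where f = "(*)"] h)
    then show "coeff (h * (1 - a)) w = coeff 1 w"
      by (simp only: left coeff_diff coeff_power_eq_0[OF assms] lessI diff_zero)
  qed
qed

section \<open>Closure properties and linear systems\<close>

lemma rational_series_add: "f \<in> rational_series \<Longrightarrow> g \<in> rational_series \<Longrightarrow> f + g \<in> rational_series"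
  and rational_series_diff: "f \<in> rational_series \<Longrightarrow> g \<in> rational_series \<Longrightarrow> f - g \<in> rational_series"
  and rational_series_mult: "f \<in> rational_series \<Longrightarrow> g \<in> rational_series \<Longrightarrow> f * g \<in> rational_series"
  and rational_series_0: "0 \<in> rational_series"
  and rational_series_1: "1 \<in> rational_series"
  and rational_series_sum: "(\<And>i. i \<in> I \<Longrightarrow> F i \<in> rational_series) \<Longrightarrow> sum F I \<in> rational_series"
  using rational_series_least(1) unfolding series_subalgebra_def
  by (blast intro: nc_series.subspace_add nc_series.subspace_diff nc_series.subspace_0
      nc_series.subspace_sum)+

lemma rational_series_inverse:
  "g \<in> rational_series \<Longrightarrow> g * h = 1 \<Longrightarrow> h * g = 1 \<Longrightarrow> h \<in> rational_series"
  using rational_series_least(3) by (auto simp: inverse_closed_def)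

lemma rational_series_linear_system:
  fixes S p :: "'i \<Rightarrow> ('x, 'k::field) nc_series"
  assumes "finite I"
    and "\<And>i. i \<in> I \<Longrightarrow> S i = p i + (\<Sum>j\<in>I. a i j * S j)"
    and "\<And>i. i \<in> I \<Longrightarrow> p i \<in> rational_series"
    and "\<And>i j. i \<in> I \<Longrightarrow> j \<in> I \<Longrightarrow> a i j \<in> rational_series"
    and "\<And>i j. i \<in> I \<Longrightarrow> j \<in> I \<Longrightarrow> coeff (a i j) [] = 0"
    and "i \<in> I"
  shows "S i \<in> rational_series"
  using assms
proof (induction I arbitrary: p a i)
  case (insert n I)
  obtain h where h: "(1 - a n n) * h = 1" "h * (1 - a n n) = 1"
    using one_minus_invertible insert.prems(4) by blast
  have "h \<in> rational_series"
    by (rule rational_series_inverse[OF _ h])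
      (simp add: insert.prems(2,3) rational_series_diff rational_series_1)
  have "(1 - a n n) * S n = p n + (\<Sum>j\<in>I. a n j * S j)"
    using insert.prems(1)[of n] insert.hyps by (simp add: algebra_simps)
  then have n: "S n = h * (p n + (\<Sum>j\<in>I. a n j * S j))"
    using h(2) by (metis mult.assoc mult_1)
  have I: "S i \<in> rational_series" if "i \<in> I" for i
  proof (rule insert.IH)
    fix i assume i: "i \<in> I"
    \<comment> \<open>Substituting the formula for \<open>S n\<close> leaves a system in the
      unknowns of \<open>I\<close> alone.\<close>
    show "S i = (p i + a i n * h * p n) + (\<Sum>j\<in>I. (a i j + a i n * h * a n j) * S j)"
    proof -
      have "S i = p i + a i n * S n + (\<Sum>j\<in>I. a i j * S j)"
        using insert.prems(1)[of i] insert.hyps i by (simp add: algebra_simps)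
      also have "\<dots> = p i + a i n * (h * (p n + (\<Sum>j\<in>I. a n j * S j))) + (\<Sum>j\<in>I. a i j * S j)"
        using n by simp
      finally show ?thesis
        by (simp add: algebra_simps sum.distrib sum_distrib_left)
    qed
    show "p i + a i n * h * p n \<in> rational_series"
      using i \<open>h \<in> rational_series\<close>
      by (simp add: insert.prems(2,3) rational_series_add rational_series_mult)
    fix j assume j: "j \<in> I"
    show "a i j + a i n * h * a n j \<in> rational_series"
      using i j \<open>h \<in> rational_series\<close>
      by (simp add: insert.prems(2,3) rational_series_add rational_series_mult)
    \<comment> \<open>Elimination keeps the constant terms zero, so the next pivot is invertible as
      well.\<close>
    show "coeff (a i j + a i n * h * a n j) [] = 0"
      using i j by (simp add: insert.prems(4))
  qed (fact that)
  moreover have "S n \<in> rational_series"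
    unfolding n using I \<open>h \<in> rational_series\<close>
    by (simp add: insert.prems(2,3) rational_series_add rational_series_mult rational_series_sum)
  ultimately show ?case
    using insert.prems(5) by auto
qed simp

definition linear_form :: "('x \<Rightarrow> 'k::field) \<Rightarrow> ('x, 'k) nc_series" where
  "linear_form r = Series (\<lambda>w. case w of [x] \<Rightarrow> r x | _ \<Rightarrow> 0)"

lemma coeff_linear_form:
  "coeff (linear_form r) w = (case w of [x] \<Rightarrow> r x | _ \<Rightarrow> 0)"
  by (simp add: linear_form_def)

text \<open>Finiteness of the alphabet enters here: it makes the linear form a polynomial.\<close>

lemma rational_series_linear_form:
  fixes r :: "'x::finite \<Rightarrow> 'k::field"
  shows "linear_form r \<in> rational_series"
proof -
  have "linear_form r = series_of_poly (\<Sum>x\<in>UNIV. Poly_Mapping.single [x] (r x))"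
  proof (rule nc_series_eqI)
    fix w :: "'x list"
    show "coeff (linear_form r) w = coeff (series_of_poly (\<Sum>x\<in>UNIV. Poly_Mapping.single [x] (r x))) w"
      by (auto simp: coeff_linear_form series_of_poly_def lookup_sum lookup_single when_def
          sum.delta split: list.split)
  qed
  then show ?thesis
    using rational_series_least(2) by auto
qed

text \<open>A linear form lives on one-letter words, so only the splitting after the first letter
  contributes.\<close>

lemma coeff_linear_form_mult_Cons: "coeff (linear_form r * f) (x # w) = r x * coeff f w"
proof -
  have "(\<Sum>(u, v) | u @ v = w. coeff (linear_form r) (x # u) * coeff f v)
      = (\<Sum>(u, v) \<in> {([], w)}. coeff (linear_form r) (x # u) * coeff f v)"
    by (rule sum.mono_neutral_right) (auto simp: coeff_linear_form split: list.splits)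
  then show ?thesis
    by (simp add: coeff_mult_Cons coeff_linear_form)
qed

section \<open>Traces\<close>

context finite_dimensional_vector_space
begin

text \<open>Fixes the basis chosen inside \<open>trace\<close> once, so that one basis serves all
  endomorphisms.\<close>

lemma trace_eq_sum_representation:
  obtains B where "finite B" "independent B" "span B = UNIV"
    and "\<And>T. trace T = (\<Sum>b\<in>B. representation B (T b) b)"
proof
  let ?B = "SOME B. independent B \<and> span B = UNIV"
  have *: "independent ?B \<and> span ?B = UNIV"
    using independent_Basis span_Basis by (intro someI_ex[of "\<lambda>B. independent B \<and> span B = UNIV"]) auto
  then show "independent ?B" "span ?B = UNIV" "finite ?B"
    using finiteI_independent by auto
  show "trace T = (\<Sum>b\<in>?B. representation ?B (T b) b)" for T
    by (simp add: trace_def Let_def)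
qed

text \<open>Both sides equal the double sum of
  \<open>\<phi> i (T b) * representation B (e i) b\<close>: expand \<open>T b\<close> along the
  \<open>e i\<close> on the left, and \<open>e i\<close> along \<open>B\<close> on the
  right.\<close>

lemma trace_eq_sum_functionals:
  assumes "finite I"
    and decomp: "\<And>v. v = (\<Sum>i\<in>I. scale (\<phi> i v) (e i))"
    and \<phi>: "\<And>i. i \<in> I \<Longrightarrow> Vector_Spaces.linear scale (*) (\<phi> i)"
    and T: "Vector_Spaces.linear scale scale T"
  shows "trace T = (\<Sum>i\<in>I. \<phi> i (T (e i)))"
proof -
  obtain B where B: "finite B" "independent B" "span B = UNIV"
    and tr: "\<And>T. trace T = (\<Sum>b\<in>B. representation B (T b) b)"
    using trace_eq_sum_representation by blast
  interpret T: Vector_Spaces.linear scale scale T by (fact T)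
  have "representation B (T b) b = (\<Sum>i\<in>I. \<phi> i (T b) * representation B (e i) b)" for b
    by (subst decomp[of "T b"]) (simp add: representation_sum representation_scale B)
  then have "trace T = (\<Sum>i\<in>I. \<Sum>b\<in>B. representation B (e i) b * \<phi> i (T b))"
    unfolding tr by (subst sum.swap) (simp add: mult.commute)
  also have "\<dots> = (\<Sum>i\<in>I. \<phi> i (T (e i)))"
  proof (rule sum.cong[OF refl])
    fix i assume "i \<in> I"
    interpret \<phi>: Vector_Spaces.linear scale "(*)" "\<phi> i" using \<phi> \<open>i \<in> I\<close> .
    have "\<phi> i (T (\<Sum>b\<in>B. scale (representation B (e i) b) b)) = (\<Sum>b\<in>B. representation B (e i) b * \<phi> i (T b))"
      by (simp add: T.sum T.scale \<phi>.sum \<phi>.scale)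
    then show "(\<Sum>b\<in>B. representation B (e i) b * \<phi> i (T b)) = \<phi> i (T (e i))"
      by (simp add: sum_representation_eq B)
  qed
  finally show ?thesis .
qed

lemma linear_representation:
  assumes "independent B" "span B = UNIV"
  shows "Vector_Spaces.linear scale (*) (\<lambda>v. representation B v b)"
  by unfold_locales (simp_all add: representation_add representation_scale assms algebra_simps)

end

text \<open>\<open>T\<close> is block triangular with respect to the image of \<open>f\<close> and a
  complement, with diagonal blocks \<open>TL\<close> and \<open>TN\<close>.\<close>

lemma trace_short_exact:
  fixes sL :: "'k::field \<Rightarrow> 'l::ab_group_add \<Rightarrow> 'l" and sM :: "'k \<Rightarrow> 'm::ab_group_add \<Rightarrow> 'm"
    and sN :: "'k \<Rightarrow> 'n::ab_group_add \<Rightarrow> 'n"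
  assumes L: "finite_dimensional_vector_space sL BL"
    and M: "finite_dimensional_vector_space sM BM"
    and N: "finite_dimensional_vector_space sN BN"
    and f: "Vector_Spaces.linear sL sM f" and g: "Vector_Spaces.linear sM sN g"
    and exact: "inj f" "range f = {m. g m = 0}" "surj g"
    and T: "Vector_Spaces.linear sM sM T"
    and fT: "\<And>l. T (f l) = f (TL l)" and gT: "\<And>m. g (T m) = TN (g m)"
  shows "vector_space.trace sM T = vector_space.trace sL TL + vector_space.trace sN TN"
proof -
  interpret L: finite_dimensional_vector_space sL BL by fact
  interpret M: finite_dimensional_vector_space sM BM by fact
  interpret N: finite_dimensional_vector_space sN BN by fact
  interpret f: Vector_Spaces.linear sL sM f by fact
  interpret g: Vector_Spaces.linear sM sN g by fact
  obtain B where B: "finite B" "L.independent B" "L.span B = UNIV"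
    and trL: "\<And>T. L.trace T = (\<Sum>b\<in>B. L.representation B (T b) b)"
    using L.trace_eq_sum_representation by blast
  obtain C where C: "finite C" "N.independent C" "N.span C = UNIV"
    and trN: "\<And>T. N.trace T = (\<Sum>b\<in>C. N.representation C (T b) b)"
    using N.trace_eq_sum_representation by blast
  \<comment> \<open>An arbitrary set-theoretic section of \<open>g\<close>, used only on the basis
    \<open>C\<close>. Extending it linearly from \<open>C\<close> and composing with
    \<open>g\<close> gives the projection \<open>q\<close> onto the span of the lifts.\<close>
  define s where "s = inv g"
  have gs: "g (s n) = n" for n
    by (simp add: s_def surj_f_inv_f exact)
  define q where "q v = (\<Sum>c\<in>C. sM (N.representation C (g v) c) (s c))" for v
  have gq: "g (q v) = g v" for v
    by (simp add: q_def g.sum g.scale gs N.sum_representation_eq C)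
  \<comment> \<open>\<open>v - q v\<close> lies in the kernel of \<open>g\<close>, which is the
    range of \<open>f\<close>; hence \<open>r\<close> is a linear retraction of
    \<open>f\<close>.\<close>
  define r where "r v = inv f (v - q v)" for v
  have fr: "f (r v) = v - q v" for v
  proof -
    have "v - q v \<in> range f"
      by (simp add: exact g.diff gq)
    then show ?thesis
      by (simp add: r_def f_inv_into_f)
  qed
  have q_add: "q (v + w) = q v + q w" for v w
    by (simp add: q_def g.add N.representation_add C M.scale_left_distrib sum.distrib)
  have q_scale: "q (sM a v) = sM a (q v)" for a v
    by (simp add: q_def g.scale N.representation_scale C M.scale_sum_right)
  have r: "Vector_Spaces.linear sM sL r"
  proof unfold_locales
    fix v w a
    have "f (r (v + w)) = f (r v + r w)"
      by (simp add: fr f.add q_add)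
    then show "r (v + w) = r v + r w"
      using exact(1) by (simp add: inj_eq)
    have "f (r (sM a v)) = f (sL a (r v))"
      by (simp add: fr f.scale q_scale M.scale_right_diff_distrib)
    then show "r (sM a v) = sL a (r v)"
      using exact(1) by (simp add: inj_eq)
  qed
  have rf: "r (f l) = l" for l
  proof -
    have "g (f l) = 0"
      using exact(2) by blast
    then have "q (f l) = 0"
      by (simp add: q_def N.representation_zero)
    then have "f (r (f l)) = f l"
      by (simp add: fr)
    then show ?thesis
      using exact(1) by (simp add: inj_eq)
  qed
  define e where "e = case_sum f s"
  define \<phi> where
    "\<phi> = case_sum (\<lambda>b v. L.representation B (r v) b) (\<lambda>c v. N.representation C (g v) c)"
  have "M.trace T = (\<Sum>i \<in> B <+> C. \<phi> i (T (e i)))"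
  proof (rule M.trace_eq_sum_functionals)
    show "finite (B <+> C)"
      by (simp add: B C)
    \<comment> \<open>This is the decomposition \<open>v = f (r v) + q v\<close> in
      coordinates.\<close>
    show "v = (\<Sum>i \<in> B <+> C. sM (\<phi> i v) (e i))" for v
    proof -
      have "(\<Sum>b\<in>B. sM (L.representation B (r v) b) (f b)) = f (r v)"
        by (simp flip: f.sum f.scale add: L.sum_representation_eq B)
      then show ?thesis
        by (simp add: sum.Plus B C e_def \<phi>_def fr flip: q_def)
    qed
    show "Vector_Spaces.linear sM (*) (\<phi> i)" for i
    proof (cases i)
      case (Inl b)
      then show ?thesis
        using Vector_Spaces.linear_compose[OF r L.linear_representation[OF B(2,3)], of b]
        by (simp add: \<phi>_def comp_def)
    next
      case (Inr c)
      then show ?thesis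
        using Vector_Spaces.linear_compose[OF g N.linear_representation[OF C(2,3)], of c]
        by (simp add: \<phi>_def comp_def)
    qed
  qed (fact T)
  \<comment> \<open>Diagonal entries only: \<open>r (T (f b)) = TL b\<close> and
    \<open>g (T (s c)) = TN c\<close>.\<close>
  also have "\<dots> = L.trace TL + N.trace TN"
    by (simp add: sum.Plus B C e_def \<phi>_def fT gT gs rf trL trN)
  finally show ?thesis .
qed

section \<open>Characteristic functions\<close>

text \<open>Scalars act through constant polynomials, so compatibility with the module action
  includes homogeneity.\<close>

lemma right_module_hom_linear:
  fixes actM :: "'m::ab_group_add \<Rightarrow> ('x, 'k::field) nc_poly \<Rightarrow> 'm"
    and actN :: "'n::ab_group_add \<Rightarrow> ('x, 'k) nc_poly \<Rightarrow> 'n"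
  assumes "right_module_hom actM actN f"
  shows "Vector_Spaces.linear (module_scale actM) (module_scale actN) f"
proof -
  interpret M: vector_space "module_scale actM"
    using assms by (intro vector_space_module_scale) (simp add: right_module_hom_def)
  interpret N: vector_space "module_scale actN"
    using assms by (intro vector_space_module_scale) (simp add: right_module_hom_def)
  show ?thesis
    using assms by unfold_locales (auto simp: right_module_hom_def module_scale_def)
qed

lemma char_fun_rational:
  fixes act :: "'m::ab_group_add \<Rightarrow> ('x::finite, 'k::field) nc_poly \<Rightarrow> 'm"
  assumes "fin_dim_module act"
  shows "char_fun act \<in> rational_series"
proof -
  obtain B0 where act: "right_module act"
    and B0: "finite_dimensional_vector_space (module_scale act) B0"
    using assms by (auto simp: fin_dim_module_def)
  interpret finite_dimensional_vector_space "module_scale act" B0 by (fact B0)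
  obtain B where B: "finite B" "independent B" "span B = UNIV"
    and tr: "\<And>T. trace T = (\<Sum>b\<in>B. representation B (T b) b)"
    using trace_eq_sum_representation by blast
  define F where "F b c = Series (\<lambda>w. representation B (module_rep act (nc_monom w) b) c)" for b c
  define a where "a b d = linear_form (\<lambda>x. representation B (generator_endo act x b) d)" for b d
  have system: "F b c = (if b = c then 1 else 0) + (\<Sum>d\<in>B. a b d * F d c)" if "b \<in> B" for b c
  proof (rule nc_series_eqI)
    fix w
    show "coeff (F b c) w = coeff ((if b = c then 1 else 0) + (\<Sum>d\<in>B. a b d * F d c)) w"
    proof (cases w)
      case Nil
      then show ?thesis
        using that by (auto simp: F_def a_def coeff_sum coeff_one coeff_linear_form
            module_rep_word[OF act] representation_basis B)
    next
      case (Cons x v)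
      let ?R = "module_rep act (nc_monom v)"
      interpret R: Vector_Spaces.linear "module_scale act" "module_scale act" ?R
        using act by (rule linear_module_rep)
      let ?u = "generator_endo act x b"
      \<comment> \<open>The first letter acts first, so its matrix entries come out as left
        coefficients of the unknowns.\<close>
      have "module_rep act (nc_monom w) b = ?R ?u"
        by (simp add: module_rep_word[OF act] Cons)
      also have "\<dots> = ?R (\<Sum>d\<in>B. module_scale act (representation B ?u d) d)"
        by (simp add: sum_representation_eq B)
      also have "\<dots> = (\<Sum>d\<in>B. module_scale act (representation B ?u d) (?R d))"
        by (simp only: R.sum R.scale)
      finally have "coeff (F b c) w = (\<Sum>d\<in>B. representation B ?u d * representation B (?R d) c)"
        by (simp add: F_def representation_sum representation_scale B)
      then show ?thesis
        by (simp add: Cons coeff_sum coeff_one a_def coeff_linear_form_mult_Cons F_def)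
    qed
  qed
  have "F b c \<in> rational_series" if "b \<in> B" for b c
    \<comment> \<open>One system for each fixed column \<open>c\<close>, with the row index as the
      unknown.\<close>
    by (rule rational_series_linear_system[where I = B and S = "\<lambda>b. F b c" and a = a
          and p = "\<lambda>b. if b = c then 1 else 0"])
      (use that in \<open>auto simp: B system rational_series_0 rational_series_1 a_def
        rational_series_linear_form coeff_linear_form\<close>)
  moreover have "char_fun act = (\<Sum>b\<in>B. F b b)"
    by (rule nc_series_eqI) (simp add: char_fun_def coeff_sum F_def tr)
  ultimately show ?thesis
    by (simp add: rational_series_sum)
qed

text \<open>Word by word this is additivity of the trace, as \<open>f\<close> and \<open>g\<close>
  intertwine the actions of each word.\<close>

lemma char_fun_short_exact:
  fixes actL :: "'l::ab_group_add \<Rightarrow> ('x, 'k::field) nc_poly \<Rightarrow> 'l"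
    and actM :: "'m::ab_group_add \<Rightarrow> ('x, 'k) nc_poly \<Rightarrow> 'm"
    and actN :: "'n::ab_group_add \<Rightarrow> ('x, 'k) nc_poly \<Rightarrow> 'n"
  assumes fin: "fin_dim_module actL" "fin_dim_module actM" "fin_dim_module actN"
    and exact: "short_exact actL actM actN f g"
  shows "char_fun actM = char_fun actL + char_fun actN"
proof (rule nc_series_eqI)
  fix w
  obtain BL BM BN where
    "finite_dimensional_vector_space (module_scale actL) BL"
    "finite_dimensional_vector_space (module_scale actM) BM"
    "finite_dimensional_vector_space (module_scale actN) BN"
    using fin by (auto simp: fin_dim_module_def)
  moreover have hom: "right_module_hom actL actM f" "right_module_hom actM actN g"
    and "inj f" "range f = {m. g m = 0}" "surj g"
    using exact by (auto simp: short_exact_def)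
  moreover have "Vector_Spaces.linear (module_scale actM) (module_scale actM)
      (module_rep actM (nc_monom w))"
    using fin by (intro linear_module_rep) (simp add: fin_dim_module_def)
  moreover have "module_rep actM (nc_monom w) (f l) = f (module_rep actL (nc_monom w) l)"
    and "g (module_rep actM (nc_monom w) m) = module_rep actN (nc_monom w) (g m)" for l m
    using hom by (simp_all add: right_module_hom_def module_rep_def)
  ultimately show "coeff (char_fun actM) w = coeff (char_fun actL + char_fun actN) w"
    by (simp add: char_fun_def trace_short_exact[OF _ _ _ right_module_hom_linear right_module_hom_linear])
qed

theorem proposition2p7:
  shows "(\<forall>act :: 'm::ab_group_add \<Rightarrow> ('x::finite, 'k::field) nc_poly \<Rightarrow> 'm.
            fin_dim_module act \<longrightarrow> char_fun act \<in> rational_series)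
       \<and> (\<forall>(act' :: 'm'::ab_group_add \<Rightarrow> ('x, 'k) nc_poly \<Rightarrow> 'm')
            (act :: 'm \<Rightarrow> ('x, 'k) nc_poly \<Rightarrow> 'm)
            (act'' :: 'm''::ab_group_add \<Rightarrow> ('x, 'k) nc_poly \<Rightarrow> 'm'') f g.
            fin_dim_module act' \<and> fin_dim_module act \<and> fin_dim_module act''
            \<and> short_exact act' act act'' f g
            \<longrightarrow> char_fun act = char_fun act' + char_fun act'')"
  using char_fun_rational char_fun_short_exact by blast

end
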